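(* Let $F_n$ and $L_n$ be the Fibonacci and Lucas numbers. For every positive integer $n$, \[ \tan^{-1}\left(\frac{F_{2n}}{F_{2n+1}}\right)=\sum_{k=1}^{2n}\tan^{-1}\left( \frac{1}{L_{2k}}\right), \] \[ \tan^{-1}\left (\frac{F_{2n-1}}{F_{2n}}\right)=\tan^{-1}2-\sum_{k=1}^{2n-1}\tan^{-1}\left( \frac{1}{L_{2k}}\right), \] \[ \tan^{-1}\left(\frac{F_{2n}}{F_{2n+1}}\right)=\tan^{-1}1-\frac{1}{2}\tan^{-1}\frac{1}{2}-\frac{1}{2}\tan^{-1}\left(\frac{2}{L_{4n+1}}\right), \] \[ \tan^{-1}\left(\frac{F_{2n-1}}{F_{2n}}\right)=\tan^{-1}1-\frac{1}{2}\tan^{-1}\frac{1}{2}+\frac{1}{2}\tan^{-1}\left(\frac{2}{L_{4n-1}}\right). \]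
   Context: The Fibonacci numbers are defined by $F_0=0$, $F_1=1$, $F_n=F_{n-1}+F_{n-2}$. The Lucas numbers are $L_n=F_{n-1}+F_{n+1}$. $\tan^{-1}$ denotes the principal branch of the arctangent, with values in $(-\pi/2,\pi/2)$. *)

theory Defs
  imports Complex_Main "HOL-Number_Theory.Fib"
begin

text \<open>The Lucas numbers $L_n = F_{n-1} + F_{n+1}$. Since the index of \<^const>\<open>fib\<close> is a natural
  number, index 0 is treated separately: there $F_{-1} = F_1 - F_0 = 1$, so $L_0 = 2$.\<close>

fun lucas :: "nat \<Rightarrow> nat" where
  "lucas 0 = 2"
| "lucas (Suc n) = fib n + fib (n + 2)"

end

theory Submission
  imports Defs
begin

text \<open>Put \<open>a\<^sub>m = arctan (F\<^sub>m / F\<^sub>m\<^sub>+\<^sub>1)\<close>. By Cassini's identity and the arctangent addition formula,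
  \<open>a\<^sub>m + a\<^sub>m\<^sub>+\<^sub>1\<close> differs from \<open>arctan 2\<close> by \<open>\<plusminus> arctan (1 / L\<^sub>2\<^sub>m\<^sub>+\<^sub>2)\<close>, which gives the two sums by
  induction. Doubling \<open>arctan 1 - a\<^sub>m = arctan ((F\<^sub>m\<^sub>+\<^sub>1 - F\<^sub>m) / (F\<^sub>m\<^sub>+\<^sub>1 + F\<^sub>m))\<close> gives the two closed
  forms.\<close>

text \<open>For positive x the hypothesis says y < 1/x, and arctan (1/x) is the complement of arctan
  x. Applied to -x and -y, the bound also keeps the sum above -pi/2.\<close>

lemma arctan_add_less_pi_half:
  fixes x y :: real
  assumes "x * y < 1"
  shows "arctan x + arctan y < pi / 2"
proof (cases "x > 0")
  case True
  then have "y < 1 / x"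
    using assms by (simp add: field_simps)
  then have "arctan y < arctan (1 / x)"
    by (simp add: arctan_less_iff)
  also have "arctan (1 / x) = pi / 2 - arctan x"
    using arctan_inverse[of x] True by (simp add: sgn_if)
  finally show ?thesis by simp
next
  case False
  then have "arctan x \<le> 0" by simp
  then show ?thesis using arctan_ubound[of y] by linarith
qed

text \<open>The condition on the product, rather than on each argument, admits the argument 2 needed
  later.\<close>

lemma arctan_add_mult_less_1:
  fixes x y :: real
  assumes "x * y < 1"
  shows "arctan x + arctan y = arctan ((x + y) / (1 - x * y))"
proof -
  have "arctan x + arctan y < pi / 2"
    using assms by (rule arctan_add_less_pi_half)
  moreover have "- (pi / 2) < arctan x + arctan y"
    using arctan_add_less_pi_half[of "- x" "- y"] assms by (simp add: arctan_minus)
  moreover have "tan (arctan x + arctan y) = (x + y) / (1 - x * y)"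
  proof -
    have "cos (arctan x + arctan y) \<noteq> 0"
      using calculation cos_gt_zero_pi[of "arctan x + arctan y"] by simp
    then show ?thesis
      by (simp add: tan_add tan_arctan)
  qed
  ultimately show ?thesis
    by (metis arctan_unique)
qed

text \<open>Cassini's identity as a quadratic form in two consecutive terms, so that later
  computations involve only these two.\<close>

lemma fib_quadratic:
  "real (fib (Suc m)) ^ 2 - real (fib (Suc m)) * real (fib m) - real (fib m) ^ 2 = (-1) ^ m"
  by (induction m) (simp_all add: power2_eq_square algebra_simps)

lemma fib_double_Suc: "fib (Suc (2 * m)) = fib (Suc m) ^ 2 + fib m ^ 2"
  using fib_add[of m m] by (simp add: power2_eq_square mult_2)

text \<open>Both Fibonacci summands have odd index and are sums of two consecutive squares; the
  quadratic form then removes \<open>fib m\<close>.\<close>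

lemma lucas_double_even:
  "real (lucas (2 * Suc m)) = 5 * real (fib (Suc m)) ^ 2 - 2 * (-1) ^ m"
proof -
  have "lucas (2 * Suc m) = fib (Suc (2 * m)) + fib (Suc (2 * Suc m))"
    by simp
  also have "\<dots> = 2 * fib (Suc m) ^ 2 + fib m ^ 2 + (fib (Suc m) + fib m) ^ 2"
    unfolding fib_double_Suc by simp
  finally show ?thesis
    using fib_quadratic[of m] by (simp add: power2_eq_square algebra_simps del: lucas.simps)
qed

lemma lucas_double_odd:
  "real (lucas (2 * m + 1)) = 5 * (real (fib m) * real (fib (Suc m))) + (-1) ^ m"
proof -
  have "fib (2 * m + 2) = fib (Suc m) * (fib (Suc m) + 2 * fib m)"
    using fib_add[of "Suc m" m] by (simp add: mult_2 mult_2_right algebra_simps)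
  \<comment> \<open>This is F(2m) = F(2m+2) - F(2m+1), rearranged to avoid subtraction of
    naturals.\<close>
  then have "fib m ^ 2 + fib (2 * m) = 2 * (fib m * fib (Suc m))"
    using fib_double_Suc[of m] by (simp add: power2_eq_square algebra_simps)
  then have "real (fib (2 * m)) = 2 * (real (fib m) * real (fib (Suc m))) - real (fib m) ^ 2"
    unfolding of_nat_eq_iff[where 'a = real, symmetric] by simp
  then show ?thesis
    using fib_quadratic[of m] fib_double_Suc[of m]
    by (simp add: power2_eq_square algebra_simps)
qed

lemma neg_one_power_mult_arctan: "(-1) ^ m * arctan x = arctan ((-1) ^ m * x)"
  by (cases "even m") (simp_all add: arctan_minus)

lemma arctan_fib_ratio_add:
  "arctan (fib m / fib (Suc m)) + arctan (fib (Suc m) / fib (Suc (Suc m)))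
     = arctan 2 - (-1) ^ m * arctan (1 / lucas (2 * Suc m))"
proof -
  define b c e :: real where "b = fib m" and "c = fib (Suc m)" and "e = (-1) ^ m"
  have c: "c \<ge> 1" and b: "b \<ge> 0"
    by (simp_all add: b_def c_def Suc_le_eq fib_neq_0_nat)
  have e: "e = 1 \<or> e = -1"
    unfolding e_def by (cases "even m") simp_all
  have q: "c\<^sup>2 - c * b - b\<^sup>2 = e"
    unfolding b_def c_def e_def by (rule fib_quadratic)
  define L where "L = 5 * c\<^sup>2 - 2 * e"
  have c2: "c\<^sup>2 \<ge> 1" using c by simp
  then have L: "L \<ge> 3" using e unfolding L_def by auto
  have less: "b / c * (c / (b + c)) < 1"
    using b c by (simp add: field_simps)
  have "arctan (b / c) + arctan (c / (b + c))
      = arctan ((b / c + c / (b + c)) / (1 - b / c * (c / (b + c))))"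
    by (rule arctan_add_mult_less_1[OF less])
  \<comment> \<open>The common denominator c (b + c) cancels, leaving (b^2 + b c + c^2) / c^2, which
    \<open>q\<close> simplifies.\<close>
  also have "(b / c + c / (b + c)) / (1 - b / c * (c / (b + c))) = 2 - e / c\<^sup>2"
    using b c unfolding q[symmetric] by (simp add: divide_simps power2_eq_square) algebra
  \<comment> \<open>Solving (2 + t) / (1 - 2 t) = 2 - e / c^2 for t gives t = -e / (5 c^2 - 2 e),
    whose denominator is the Lucas number \<open>L\<close>.\<close>
  also have "2 - e / c\<^sup>2 = (2 + - e / L) / (1 - 2 * (- e / L))"
  proof -
    have "L + 2 * e = 5 * c\<^sup>2" by (simp add: L_def)
    then have "(2 + - e / L) / (1 - 2 * (- e / L)) = (2 * L - e) / (5 * c\<^sup>2)"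
      using L c by (simp add: field_simps)
    also have "\<dots> = 2 - e / c\<^sup>2"
      using c by (simp add: L_def field_simps)
    finally show ?thesis by simp
  qed
  also have "arctan \<dots> = arctan 2 + arctan (- e / L)"
  proof -
    have "2 * (- e / L) < 1" using L e by (auto simp: field_simps)
    then show ?thesis by (rule arctan_add_mult_less_1[symmetric])
  qed
  finally have "arctan (b / c) + arctan (c / (b + c)) = arctan 2 - arctan (e * (1 / L))"
    by (simp add: arctan_minus)
  then show ?thesis
    unfolding neg_one_power_mult_arctan lucas_double_even
    by (simp add: b_def c_def e_def L_def add.commute)
qed

text \<open>Each induction step replaces the ratio's arctangent by arctan 2 minus it, up to one new
  term, so arctan 2 appears and cancels alternately.\<close>

lemma arctan_fib_ratio_sum:
  "arctan (fib m / fib (Suc m)) =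
     (if even m then \<Sum>k = 1..m. arctan (1 / lucas (2 * k))
      else arctan 2 - (\<Sum>k = 1..m. arctan (1 / lucas (2 * k))))"
proof (induction m)
  case 0
  show ?case by simp
next
  case (Suc m)
  then show ?case
    using arctan_fib_ratio_add[of m] by (simp del: lucas.simps fib.simps mult_Suc_right split: if_splits)
qed

lemma arctan_fib_ratio_closed_form:
  assumes "m \<ge> 1"
  shows "arctan (fib m / fib (Suc m))
    = arctan 1 - 1 / 2 * arctan (1 / 2) - 1 / 2 * ((-1) ^ m * arctan (2 / lucas (2 * m + 1)))"
proof -
  define b c e :: real where "b = fib m" and "c = fib (Suc m)" and "e = (-1) ^ m"
  have c: "c \<ge> 1" and b: "b \<ge> 1"
    using assms by (simp_all add: b_def c_def Suc_le_eq fib_neq_0_nat)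
  have e: "e = 1 \<or> e = -1"
    unfolding e_def by (cases "even m") simp_all
  have q: "c\<^sup>2 - c * b - b\<^sup>2 = e"
    unfolding b_def c_def e_def by (rule fib_quadratic)
  define L where "L = 5 * (b * c) + e"
  have bc: "b * c \<ge> 1" using b c mult_mono[of 1 b 1 c] by simp
  then have L: "L \<ge> 4" using e unfolding L_def by auto
  define x where "x = (c - b) / (c + b)"
  have "1 * (- (b / c)) < 1" using b c by (simp add: field_simps)
  then have "arctan 1 + arctan (- (b / c)) = arctan ((1 + - (b / c)) / (1 - 1 * (- (b / c))))"
    by (rule arctan_add_mult_less_1)
  also have "(1 + - (b / c)) / (1 - 1 * (- (b / c))) = x"
    using b c by (simp add: x_def divide_simps)
  finally have x: "arctan 1 - arctan (b / c) = arctan x"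
    by (simp add: arctan_minus)
  \<comment> \<open>Since \<open>b\<close> and \<open>c\<close> are positive, this makes x^2 < 1, so
    doubling arctan x stays within the principal branch.\<close>
  have x2: "1 - x * x = 4 * (b * c) / (c + b)\<^sup>2"
    using b c by (simp add: x_def divide_simps power2_eq_square) algebra
  also have "\<dots> > 0" using b c by simp
  finally have "x * x < 1" by simp
  then have "arctan x + arctan x = arctan ((x + x) / (1 - x * x))"
    by (rule arctan_add_mult_less_1)
  also have "(x + x) / (1 - x * x) = (c\<^sup>2 - b\<^sup>2) / (2 * (b * c))"
    unfolding x2 using b c by (simp add: x_def divide_simps power2_eq_square) algebra
  \<comment> \<open>By \<open>q\<close> the left side is 1/2 + e / (2 b c). Setting it equal to (1/2
    + t) / (1 - t/2) yields t = 2 e / (5 b c + e).\<close>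
  also have "\<dots> = (1 / 2 + 2 * e / L) / (1 - 1 / 2 * (2 * e / L))"
  proof -
    have "1 / 2 + 2 * e / L = (L + 4 * e) / (2 * L)" "1 - 1 / 2 * (2 * e / L) = (L - e) / L"
      using L by (simp_all add: field_simps)
    then have "(1 / 2 + 2 * e / L) / (1 - 1 / 2 * (2 * e / L)) = (L + 4 * e) / (2 * (L - e))"
      using L by simp
    also have "L - e = 5 * (b * c)" by (simp add: L_def)
    also have "L + 4 * e = 5 * (c\<^sup>2 - b\<^sup>2)"
      unfolding L_def using q by (simp add: algebra_simps)
    also have "5 * (c\<^sup>2 - b\<^sup>2) / (2 * (5 * (b * c))) = (c\<^sup>2 - b\<^sup>2) / (2 * (b * c))"
      using b c by (simp add: divide_simps)
    finally show ?thesis by (rule sym)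
  qed
  also have "arctan \<dots> = arctan (1 / 2) + arctan (2 * e / L)"
  proof -
    have "1 / 2 * (2 * e / L) < 1" using L e by (auto simp: field_simps)
    then show ?thesis by (rule arctan_add_mult_less_1[symmetric])
  qed
  finally have "2 * (arctan 1 - arctan (b / c)) = arctan (1 / 2) + arctan (e * (2 / L))"
    unfolding x by (simp add: mult.commute)
  then show ?thesis
    unfolding neg_one_power_mult_arctan lucas_double_odd
    by (simp add: b_def c_def e_def L_def)
qed

theorem theorem8:
  fixes n :: nat
  assumes "n \<ge> 1"
  shows "arctan (real (fib (2 * n)) / real (fib (2 * n + 1)))
           = (\<Sum>k = 1..2 * n. arctan (1 / real (lucas (2 * k))))
       \<and> arctan (real (fib (2 * n - 1)) / real (fib (2 * n)))
           = arctan 2 - (\<Sum>k = 1..2 * n - 1. arctan (1 / real (lucas (2 * k))))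
       \<and> arctan (real (fib (2 * n)) / real (fib (2 * n + 1)))
           = arctan 1 - 1 / 2 * arctan (1 / 2) - 1 / 2 * arctan (2 / real (lucas (4 * n + 1)))
       \<and> arctan (real (fib (2 * n - 1)) / real (fib (2 * n)))
           = arctan 1 - 1 / 2 * arctan (1 / 2) + 1 / 2 * arctan (2 / real (lucas (4 * n - 1)))"
proof -
  \<comment> \<open>The cases m = 2n and m = 2n - 1 select the two branches and the two signs; n >=
    1 makes the truncated subtractions exact.\<close>
  have odd: "odd (2 * n - 1)" and Suc: "Suc (2 * n - 1) = 2 * n"
    and idx: "2 * (2 * n - 1) + 1 = 4 * n - 1" and pos: "2 * n - 1 \<ge> 1" "2 * n \<ge> 1"
    using assms by auto
  show ?thesis
    using arctan_fib_ratio_sum[of "2 * n"] arctan_fib_ratio_sum[of "2 * n - 1"]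
      arctan_fib_ratio_closed_form[OF pos(2)] arctan_fib_ratio_closed_form[OF pos(1)] odd
    unfolding Suc idx by (simp del: lucas.simps fib.simps)
qed

end
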